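(* Let $I$ be an analytic $P$-ideal on $\mathbb{N}$ such that $\mathrm{Fin} \subsetneq I$. Then the group $S_I = \{ g \in S_\infty : \mathrm{supp}(g) \in I \}$, equipped with its Polish group topology $\tau_I$, has ample generics.
   Context: $\mathbb{N}=\{0,1,2,\ldots\}$; $\mathrm{Fin}$ is the ideal of finite subsets of $\mathbb{N}$; $S_\infty$ is the group of all permutations of $\mathbb{N}$; for $g \in S_\infty$, $\mathrm{supp}(g) = \{n \in \mathbb{N} : g(n) \neq n\}$. An ideal $I$ on $\mathbb{N}$ is a family of subsets of $\mathbb{N}$ closed under taking subsets and finite unions. It is analytic if it is an analytic subset of $\mathcal{P}(\mathbb{N}) \cong 2^{\mathbb{N}}$. It is a $P$-ideal if for every sequence $(A_k)_{k\in\mathbb{N}}$ of elements of $I$ there is $A \in I$ such that $A_k \setminus A$ is finite for every $k$. A lower semi-continuous submeasure on $\mathbb{N}$ is a function $\phi: \mathcal{P}(\mathbb{N}) \to [0,\infty]$ such that: $\phi(\emptyset)=0$; $A \subseteq B$ implies $\phi(A) \leq \phi(B)$; $\phi(A\cup B) \leq \phi(A)+\phi(B)$ and $\phi(\{n\})<\infty$ for $n \in \mathbb{N}$; and $\phi(\bigcup_m A_m) = \lim_m \phi(A_m)$ whenever $A_0 \subseteq A_1 \subseteq \ldots$. Put $\mathrm{Exh}(\phi) = \{A \subseteq \mathbb{N} : \lim_m \phi(A \setminus [0,m]) = 0\}$. Every analytic $P$-ideal $I \supseteq \mathrm{Fin}$ is of the form $I = \mathrm{Exh}(\phi)$ for some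 lower semi-continuous submeasure $\phi$ (known result of Solecki), and $\phi$ can be chosen with $\phi(\{n\})>0$ for all $n$. The group $S_I$ is a Polish group in the topology $\tau_I$ given by the metric $d(f,g) = \phi(\{n \in \mathbb{N} : f(n) \neq g(n)\})$ for such a $\phi$ (known result of Tsankov). A Polish group is a separable, completely metrizable topological group. A Polish group $G$ has ample generics if for every $n \in \mathbb{N}$ the diagonal conjugation action of $G$ on $G^{n+1}$, $g.(g_0,\ldots,g_n) = (g g_0 g^{-1}, \ldots, g g_n g^{-1})$, has a comeager orbit. *)

theory Defs
  imports "HOL-Analysis.Analysis" "HOL-Algebra.Bij"
begin

section \<open>Ideals on the natural numbers\<close>

definition ideal_on_nat :: "nat set set \<Rightarrow> bool" where
  "ideal_on_nat I \<longleftrightarrow>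
     {} \<in> I \<and> (\<forall>A\<in>I. \<forall>B. B \<subseteq> A \<longrightarrow> B \<in> I) \<and> (\<forall>A\<in>I. \<forall>B\<in>I. A \<union> B \<in> I)"

text \<open>A family of subsets of the naturals is analytic if it is empty or a continuous image of
  Baire space. Sets are identified with their characteristic functions, and both function types
  carry the product topology of discrete spaces.\<close>

definition analytic_family :: "nat set set \<Rightarrow> bool" where
  "analytic_family I \<longleftrightarrow>
     I = {} \<or>
     (\<exists>f :: (nat \<Rightarrow> nat) \<Rightarrow> (nat \<Rightarrow> bool).
        continuous_on UNIV f \<and> range f = (\<lambda>A n. n \<in> A) ` I)"

definition P_ideal :: "nat set set \<Rightarrow> bool" where
  "P_ideal I \<longleftrightarrow>
     ideal_on_nat I \<and>
     (\<forall>A :: nat \<Rightarrow> nat set. (\<forall>k. A k \<in> I) \<longrightarrow> (\<exists>B\<in>I. \<forall>k. finite (A k - B)))"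


section \<open>Lower semi-continuous submeasures\<close>

definition lsc_submeasure :: "(nat set \<Rightarrow> ennreal) \<Rightarrow> bool" where
  "lsc_submeasure \<phi> \<longleftrightarrow>
     \<phi> {} = 0 \<and>
     (\<forall>A B. A \<subseteq> B \<longrightarrow> \<phi> A \<le> \<phi> B) \<and>
     (\<forall>A B. \<phi> (A \<union> B) \<le> \<phi> A + \<phi> B) \<and>
     (\<forall>n. \<phi> {n} < \<infinity>) \<and>
     (\<forall>A :: nat \<Rightarrow> nat set. incseq A \<longrightarrow> (\<lambda>m. \<phi> (A m)) \<longlonglongrightarrow> \<phi> (\<Union>m. A m))"

definition Exh :: "(nat set \<Rightarrow> ennreal) \<Rightarrow> nat set set" where
  "Exh \<phi> = {A. (\<lambda>m. \<phi> (A - {..m})) \<longlonglongrightarrow> 0}"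


section \<open>Ample generics\<close>

definition topological_group :: "('a, 'b) monoid_scheme \<Rightarrow> 'a topology \<Rightarrow> bool" where
  "topological_group G T \<longleftrightarrow>
     group G \<and> topspace T = carrier G \<and>
     continuous_map (prod_topology T T) T (\<lambda>(x, y). x \<otimes>\<^bsub>G\<^esub> y) \<and>
     continuous_map T T (\<lambda>x. inv\<^bsub>G\<^esub> x)"

definition polish_group :: "('a, 'b) monoid_scheme \<Rightarrow> 'a topology \<Rightarrow> bool" where
  "polish_group G T \<longleftrightarrow>
     topological_group G T \<and> separable_space T \<and> completely_metrizable_space T"

definition nowhere_dense_in :: "'a topology \<Rightarrow> 'a set \<Rightarrow> bool" where
  "nowhere_dense_in X S \<longleftrightarrow> S \<subseteq> topspace X \<and> X interior_of (X closure_of S) = {}"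

definition meager_in :: "'a topology \<Rightarrow> 'a set \<Rightarrow> bool" where
  "meager_in X S \<longleftrightarrow>
     (\<exists>N :: nat \<Rightarrow> 'a set. (\<forall>k. nowhere_dense_in X (N k)) \<and> S = (\<Union>k. N k))"

definition comeager_in :: "'a topology \<Rightarrow> 'a set \<Rightarrow> bool" where
  "comeager_in X S \<longleftrightarrow> S \<subseteq> topspace X \<and> meager_in X (topspace X - S)"

text \<open>Tuples \<open>(x\<^sub>0, \<dots>, x\<^sub>n)\<close> are the extensional functions on \<open>{..n}\<close>, that is, the points of
  \<^term>\<open>product_topology (\<lambda>_. T) {..n}\<close>.\<close>

definition diag_conj_orbit ::
    "('a, 'b) monoid_scheme \<Rightarrow> nat \<Rightarrow> (nat \<Rightarrow> 'a) \<Rightarrow> (nat \<Rightarrow> 'a) set" where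
  "diag_conj_orbit G n x =
     (\<lambda>g. \<lambda>i\<in>{..n}. g \<otimes>\<^bsub>G\<^esub> x i \<otimes>\<^bsub>G\<^esub> inv\<^bsub>G\<^esub> g) ` carrier G"

definition ample_generics :: "('a, 'b) monoid_scheme \<Rightarrow> 'a topology \<Rightarrow> bool" where
  "ample_generics G T \<longleftrightarrow>
     polish_group G T \<and>
     (\<forall>n :: nat. \<exists>x \<in> {..n} \<rightarrow>\<^sub>E carrier G.
        comeager_in (product_topology (\<lambda>_. T) {..n}) (diag_conj_orbit G n x))"


section \<open>The group of permutations supported in an ideal\<close>

definition supp :: "(nat \<Rightarrow> nat) \<Rightarrow> nat set" where
  "supp g = {n. g n \<noteq> n}"

definition S_ideal :: "nat set set \<Rightarrow> (nat \<Rightarrow> nat) monoid" where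
  "S_ideal I = (BijGroup UNIV)\<lparr>carrier := {g \<in> Bij UNIV. supp g \<in> I}\<rparr>"

text \<open>If \<open>I = Exh \<phi>\<close> then \<open>\<phi>\<close> is finite on \<open>I\<close>, and two elements of \<^term>\<open>S_ideal I\<close> differ on
  a set in \<open>I\<close> only; hence \<^const>\<open>enn2real\<close> never truncates an infinite value below. If \<open>\<phi>\<close> is
  moreover positive on singletons, this is a metric.\<close>

definition tau :: "nat set set \<Rightarrow> (nat set \<Rightarrow> ennreal) \<Rightarrow> (nat \<Rightarrow> nat) topology" where
  "tau I \<phi> =
     Metric_space.mtopology (carrier (S_ideal I)) (\<lambda>f g. enn2real (\<phi> {n. f n \<noteq> g n}))"

end

(* Fix an infinite set A in I. A tuple is generic if every point lies in a finite set invariant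
   under the tuple and, for every tuple s of permutations of a finite set, A contains infinitely
   many disjoint invariant copies of s. Finitely supported permutations are dense, and a copy of s
   can be added on a tail of A, which has small submeasure, so generic tuples form a countable
   intersection of dense open sets.

   Given two generic tuples g and g', let V be the union of A with all the supports. It lies in I
   and is invariant under both tuples, and a back-and-forth argument yields a bijection of V that
   carries g to g'. Extended by the identity, it is an element of S_I conjugating g to g'. The copies
   are sought in A, rather than anywhere, to make the conjugating permutation supported in I. *)

theory Submission
  imports Defs "HOL-Combinatorics.Permutations"
begin

section \<open>Comeager sets\<close>

text \<open>The back-and-forth needs no amalgamation. Since every point lies in a finite invariant
  set, a finite partial isomorphism can be kept invariant, and a new point then requires only a
  finite invariant set disjoint from the old domain. Its image can be any fresh copy of that action,
  with no compatibility condition between the old part and the new one. Richness persists when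
  \<open>V\<close> grows, as long as \<open>V\<close> stays invariant. Therefore \<open>V\<close>
  can be chosen after both tuples are known. Points of \<open>V\<close> that one tuple moves and the
  other fixes do no harm: copies of the one-point action supply infinitely many common fixed points
  of each tuple inside \<open>A\<close>. Ample generics also includes that the group is Polish. The
  obstacle there is that the defining metric is left-invariant, and a limit of permutations along it
  could fail to be onto; completeness is therefore shown for an equivalent two-sided metric.\<close>

lemma comeager_inI:
  assumes "countable \<D>"
    and dense_open: "\<And>D. D \<in> \<D> \<Longrightarrow> openin X D \<and> X closure_of D = topspace X"
    and "S \<subseteq> topspace X" and sub: "topspace X \<inter> \<Inter>\<D> \<subseteq> S"
  shows "comeager_in X S"
proof -
  \<comment> \<open>Inserting the whole space, itself open and dense, makes the family nonempty, so
    that it can be enumerated even if \<open>\<D>\<close> is empty.\<close>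
  define D where "D = from_nat_into (insert (topspace X) \<D>)"
  have D_in: "D k \<in> insert (topspace X) \<D>" for k
    unfolding D_def by (rule from_nat_into) simp
  have D_ran: "range D = insert (topspace X) \<D>"
    unfolding D_def using \<open>countable \<D>\<close> by (intro range_from_nat_into) auto
  have D: "openin X (D k)" "X closure_of (D k) = topspace X" for k
    using D_in[of k] dense_open closure_of_topspace[of X] by auto
  \<comment> \<open>\<open>S\<close> is removed because \<open>meager_in\<close> asks for equality
    with the union, not mere inclusion; subsets of nowhere dense sets stay nowhere dense.\<close>
  define N where "N k = topspace X - D k - S" for k
  have "nowhere_dense_in X (N k)" for k
  proof -
    have "closedin X (topspace X - D k)"
      using D by blast
    then have "X closure_of N k \<subseteq> topspace X - D k"
      unfolding N_def by (intro closure_of_minimal) auto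
    then have "X interior_of (X closure_of N k) \<subseteq> X interior_of (topspace X - D k)"
      by (rule interior_of_mono)
    also have "\<dots> = {}"
      using D by (simp add: interior_of_complement)
    finally show ?thesis
      unfolding nowhere_dense_in_def N_def by auto
  qed
  moreover have "topspace X - S = (\<Union>k. N k)"
  proof -
    have "topspace X - S \<subseteq> (\<Union>k. N k)"
    proof
      fix x assume x: "x \<in> topspace X - S"
      then obtain E where "E \<in> \<D>" "x \<notin> E"
        using sub by blast
      moreover from this D_ran obtain k where "E = D k"
        by (metis insertI2 rangeE)
      ultimately show "x \<in> (\<Union>k. N k)"
        using x by (auto simp: N_def)
    qed
    then show ?thesis
      by (auto simp: N_def)
  qed
  ultimately show ?thesis
    using \<open>S \<subseteq> topspace X\<close> unfolding comeager_in_def meager_in_def by blast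
qed

text \<open>The finiteness condition on basic boxes is left out, since the index set is always
  \<open>{..n}\<close>.\<close>

lemma dense_in_product_topologyI:
  assumes "D \<subseteq> topspace (product_topology X I)"
    and "\<And>U f. (\<And>i. i \<in> I \<Longrightarrow> openin (X i) (U i)) \<Longrightarrow> f \<in> Pi\<^sub>E I U \<Longrightarrow> D \<inter> Pi\<^sub>E I U \<noteq> {}"
  shows "product_topology X I closure_of D = topspace (product_topology X I)"
  unfolding dense_intersects_open
proof (intro allI impI)
  fix T assume T: "openin (product_topology X I) T \<and> T \<noteq> {}"
  then obtain f where "f \<in> T"
    by blast
  with T obtain U where "\<And>i. i \<in> I \<Longrightarrow> openin (X i) (U i)" "f \<in> Pi\<^sub>E I U" "Pi\<^sub>E I U \<subseteq> T"
    unfolding openin_product_topology_alt by metis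
  then show "D \<inter> T \<noteq> {}"
    using assms(2)[of U f] by blast
qed

section \<open>Permutations and their supports\<close>

text \<open>Plain \<open>inv\<close> would be read as the inverse in the implicit structure of HOL-Algebra.\<close>

abbreviation pinv :: "(nat \<Rightarrow> nat) \<Rightarrow> nat \<Rightarrow> nat" where
  "pinv g \<equiv> inv_into UNIV g"

lemma Bij_UNIV: "g \<in> Bij UNIV \<longleftrightarrow> bij g"
  by (simp add: Bij_def extensional_def)

lemma supp_comp: "supp (g \<circ> h) \<subseteq> supp g \<union> supp h"
  by (auto simp: supp_def)

lemma supp_inv: "bij g \<Longrightarrow> supp (pinv g) = supp g"
  unfolding supp_def by (metis bij_inv_eq_iff)

lemma image_supp: "inj h \<Longrightarrow> h x \<noteq> x \<Longrightarrow> h x \<in> supp h"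
  by (auto simp: supp_def inj_eq)

definition diff :: "(nat \<Rightarrow> nat) \<Rightarrow> (nat \<Rightarrow> nat) \<Rightarrow> nat set" where
  "diff f g = {n. f n \<noteq> g n}"

text \<open>The image is taken under \<open>f\<close> alone, so continuity of inversion at a fixed
  \<open>f\<close> reduces to the effect of \<open>f\<close> on small sets.\<close>

lemma diff_inv: "bij f \<Longrightarrow> bij g \<Longrightarrow> diff (pinv f) (pinv g) = f ` diff f g"
proof -
  assume "bij f" "bij g"
  then have "pinv f x \<noteq> pinv g x \<longleftrightarrow> f (pinv f x) \<noteq> g (pinv f x)" for x
    by (metis bij_inv_eq_iff)
  then show ?thesis
    unfolding diff_def bij_image_Collect_eq[OF \<open>bij f\<close>] by simp
qed

text \<open>The restriction of \<open>g\<close> to \<open>B\<close>, the moved points up to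
  \<open>m\<close>, is completed to a permutation of \<open>C\<close>: what remains of
  \<open>C\<close> outside \<open>B\<close> and outside the image of \<open>B\<close> has equal
  size. Staying inside \<open>supp g\<close> keeps the disagreement of \<open>h\<close> with
  \<open>g\<close> in a tail of that support.\<close>

lemma bij_extend_finite:
  fixes g :: "nat \<Rightarrow> nat"
  assumes "bij g"
  obtains h where "bij h" "finite (supp h)" "supp h \<subseteq> supp g" "\<And>x. x \<le> m \<Longrightarrow> h x = g x"
proof -
  have "inj g"
    using assms by (simp add: bij_is_inj)
  define B where "B = supp g \<inter> {..m}"
  define C where "C = B \<union> g ` B"
  have fin: "finite B" "finite C"
    by (auto simp: B_def C_def)
  have gB: "g ` B \<subseteq> supp g"
    using \<open>inj g\<close> by (auto simp: B_def supp_def dest: injD)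
  have card: "card (C - B) = card (C - g ` B)"
    using fin card_image[OF inj_on_subset[OF \<open>inj g\<close> subset_UNIV], of B]
    by (simp add: card_Diff_subset C_def)
  obtain q where q: "bij_betw q (C - B) (C - g ` B)"
    using finite_same_card_bij[OF _ _ card] fin by blast
  define h where "h x = (if x \<in> B then g x else if x \<in> C then q x else x)" for x
  have "bij_betw h B (g ` B)"
    using \<open>inj g\<close> by (auto simp: h_def bij_betw_def inj_on_def dest: injD)
  moreover have "bij_betw h (C - B) (C - g ` B)"
    using q by (subst bij_betw_cong[where g = q]) (auto simp: h_def)
  ultimately have "bij_betw h (B \<union> (C - B)) (g ` B \<union> (C - g ` B))"
    by (rule bij_betw_combine) auto
  moreover have "bij_betw h (- C) (- C)"
    by (subst bij_betw_cong[where g = id]) (auto simp: h_def C_def)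
  ultimately have "bij_betw h ((B \<union> (C - B)) \<union> - C) ((g ` B \<union> (C - g ` B)) \<union> - C)"
    by (rule bij_betw_combine) (auto simp: C_def)
  moreover have "(B \<union> (C - B)) \<union> - C = UNIV" "(g ` B \<union> (C - g ` B)) \<union> - C = UNIV"
    by (auto simp: C_def)
  ultimately have "bij h"
    by simp
  moreover have "supp h \<subseteq> C"
    by (auto simp: supp_def h_def C_def split: if_splits)
  moreover have "C \<subseteq> supp g"
    using gB by (auto simp: C_def B_def)
  moreover have "h x = g x" if "x \<le> m" for x
  proof (cases "x \<in> B")
    case False
    then have "x \<notin> supp g"
      using that by (auto simp: B_def)
    then show ?thesis
      using False \<open>C \<subseteq> supp g\<close> by (auto simp: h_def supp_def)
  qed (simp add: h_def)
  ultimately show ?thesis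
    using that fin finite_subset by blast
qed

lemma countable_finite_supp: "countable {h. bij h \<and> finite (supp h)}"
proof (rule countable_subset)
  show "{h. bij h \<and> finite (supp h)} \<subseteq> (\<Union>N. {p. p permutes {..<N}})"
  proof clarify
    fix h assume h: "bij h" "finite (supp h)"
    obtain N where "supp h \<subseteq> {..<N}"
      using finite_nat_iff_bounded h(2) by blast
    then have "h permutes {..<N}"
      using h(1) by (auto simp: permutes_def bij_iff supp_def subset_iff)
    then show "h \<in> (\<Union>N. {p. p permutes {..<N}})"
      by blast
  qed
  show "countable (\<Union>N. {p. p permutes {..<N::nat}})"
    by (rule countable_UN) (auto intro: countable_finite finite_permutations)
qed

section \<open>Back and forth\<close>

text \<open>In the last clause, the tuple \<open>s\<close> codes a finite set \<open>{..<N}\<close> with an action of the free group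
  on \<open>n + 1\<close> generators, and \<open>j\<close> is an equivariant embedding of it; the bound \<open>m\<close> yields infinitely
  many disjoint copies.\<close>

definition rich :: "nat \<Rightarrow> nat set \<Rightarrow> (nat \<Rightarrow> nat \<Rightarrow> nat) \<Rightarrow> bool" where
  "rich n V g \<longleftrightarrow>
     (\<forall>i\<le>n. inj (g i) \<and> g i ` V \<subseteq> V) \<and>
     (\<forall>x. \<exists>F. finite F \<and> x \<in> F \<and> (\<forall>i\<le>n. g i ` F \<subseteq> F)) \<and>
     (\<forall>(N::nat) s m. (\<forall>i\<le>n. s i permutes {..<N}) \<longrightarrow>
        (\<exists>j. inj_on j {..<N} \<and> j ` {..<N} \<subseteq> V - {..m} \<and>
             (\<forall>i\<le>n. \<forall>a<N. g i (j a) = j (s i a))))"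

lemma rich_copies:
  fixes N :: nat
  assumes "rich n V g" and "\<And>i. i \<le> n \<Longrightarrow> s i permutes {..<N}"
  obtains j where "inj_on j {..<N}" "j ` {..<N} \<subseteq> V - {..m}"
    "\<And>i a. i \<le> n \<Longrightarrow> a < N \<Longrightarrow> g i (j a) = j (s i a)"
proof -
  have "\<exists>j. inj_on j {..<N} \<and> j ` {..<N} \<subseteq> V - {..m} \<and>
      (\<forall>i\<le>n. \<forall>a<N. g i (j a) = j (s i a))"
    using assms(1)[unfolded rich_def, THEN conjunct2, THEN conjunct2, rule_format] assms(2)
    by blast
  then show ?thesis
    using that by auto
qed

text \<open>This is the graph of an equivariant bijection between finite invariant subsets of
  \<open>V\<close>. As a relation, it can be reversed to obtain the backward half from the forward
  half.\<close>

definition partial_iso ::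
    "nat \<Rightarrow> nat set \<Rightarrow> (nat \<Rightarrow> nat \<Rightarrow> nat) \<Rightarrow> (nat \<Rightarrow> nat \<Rightarrow> nat) \<Rightarrow> (nat \<times> nat) set \<Rightarrow> bool" where
  "partial_iso n V g g' R \<longleftrightarrow>
     finite R \<and> R \<subseteq> V \<times> V \<and>
     (\<forall>x y x' y'. (x, y) \<in> R \<longrightarrow> (x', y') \<in> R \<longrightarrow> (x = x' \<longleftrightarrow> y = y')) \<and>
     (\<forall>x y i. (x, y) \<in> R \<longrightarrow> i \<le> n \<longrightarrow> (g i x, g' i y) \<in> R)"

lemma partial_isoD:
  assumes "partial_iso n V g g' R"
  shows "finite R" "R \<subseteq> V \<times> V"
    "\<And>x y x' y'. (x, y) \<in> R \<Longrightarrow> (x', y') \<in> R \<Longrightarrow> x = x' \<longleftrightarrow> y = y'"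
    "\<And>x y i. (x, y) \<in> R \<Longrightarrow> i \<le> n \<Longrightarrow> (g i x, g' i y) \<in> R"
  using assms unfolding partial_iso_def by blast+

lemma partial_iso_converse:
  "partial_iso n V g g' R \<Longrightarrow> partial_iso n V g' g (R\<inverse>)"
  unfolding partial_iso_def by (auto simp: finite_converse)

text \<open>The part of a finite invariant set around \<open>x\<close> that is not yet treated is
  again invariant; richness of \<open>g'\<close> provides a copy of it beyond the range of
  \<open>R\<close>, and the union of the two graphs is the extension.\<close>

lemma partial_iso_extend:
  assumes g: "rich n V g" and g': "rich n V g'" and R: "partial_iso n V g g' R" and "x \<in> V"
  obtains R' where "partial_iso n V g g' R'" "R \<subseteq> R'" "x \<in> Domain R'"
proof -
  note R = partial_isoD[OF R]
  obtain F where F: "finite F" "x \<in> F" "\<And>i. i \<le> n \<Longrightarrow> g i ` F \<subseteq> F"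
    using g unfolding rich_def by metis
  have inj: "inj (g i)" and V: "g i ` V \<subseteq> V" if "i \<le> n" for i
    using g that by (auto simp: rich_def)
  define Q where "Q = (F \<inter> V) - Domain R"
  have "finite Q"
    using F(1) by (simp add: Q_def)
  \<comment> \<open>Equality, not just inclusion, is what prevents points outside the domain from
    being mapped into it; it comes from injectivity on a finite set.\<close>
  have Dom: "g i ` Domain R = Domain R" if "i \<le> n" for i
  proof (rule endo_inj_surj)
    show "finite (Domain R)"
      using R(1) by (simp add: finite_Domain)
    show "g i ` Domain R \<subseteq> Domain R"
      using R(4)[OF _ that] by blast
    show "inj_on (g i) (Domain R)"
      using inj[OF that] inj_on_subset by blast
  qed
  have Q: "g i ` Q \<subseteq> Q" if i: "i \<le> n" for i
  proof (intro image_subsetI)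
    fix y assume y: "y \<in> Q"
    have "g i y \<notin> Domain R"
    proof
      assume "g i y \<in> Domain R"
      then obtain z where "z \<in> Domain R" "g i y = g i z"
        using Dom[OF i] by (metis imageE)
      then show False
        using inj[OF i] y by (auto simp: Q_def inj_eq)
    qed
    then show "g i y \<in> Q"
      using y F(3)[OF i] V[OF i] unfolding Q_def by blast
  qed
  define N where "N = card Q"
  obtain b where b: "bij_betw b {..<N} Q"
    using ex_bij_betw_nat_finite[OF \<open>finite Q\<close>] by (auto simp: N_def atLeast0LessThan)
  \<comment> \<open>The action on \<open>Q\<close>, transported along \<open>b\<close> to an initial
    segment. The default value \<open>a\<close> beyond \<open>N\<close> is what
    \<open>permutes\<close> requires.\<close>
  define s where "s i a = (if a < N then inv_into {..<N} b (g i (b a)) else a)" for i a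
  have s: "b (s i a) = g i (b a)" "s i a < N" if "i \<le> n" "a < N" for i a
  proof -
    have "b a \<in> Q"
      using b \<open>a < N\<close> by (auto simp: bij_betw_def)
    then have "g i (b a) \<in> Q"
      using Q[OF \<open>i \<le> n\<close>] by blast
    then have *: "g i (b a) \<in> b ` {..<N}"
      using b by (simp add: bij_betw_def)
    show "b (s i a) = g i (b a)"
      using f_inv_into_f[OF *] \<open>a < N\<close> by (simp add: s_def)
    show "s i a < N"
      using inv_into_into[OF *] \<open>a < N\<close> by (simp add: s_def)
  qed
  have s_perm: "s i permutes {..<N}" if "i \<le> n" for i
  proof (rule bij_imp_permutes)
    have inj_s: "inj_on (s i) {..<N}"
    proof (rule inj_onI)
      fix a a' assume a: "a \<in> {..<N}" "a' \<in> {..<N}" "s i a = s i a'"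
      then have "g i (b a) = g i (b a')"
        using s(1)[OF that] by (metis lessThan_iff)
      then have "b a = b a'"
        using inj[OF that] by (simp add: inj_eq)
      then show "a = a'"
        using a b by (auto simp: bij_betw_def inj_on_def)
    qed
    moreover have "s i ` {..<N} \<subseteq> {..<N}"
      using s(2)[OF that] by auto
    ultimately show "bij_betw (s i) {..<N} {..<N}"
      unfolding bij_betw_def using endo_inj_surj[of "{..<N}" "s i"] by blast
    show "\<And>a. a \<notin> {..<N} \<Longrightarrow> s i a = a"
      by (simp add: s_def)
  qed
  \<comment> \<open>The bound \<open>m\<close> forces the copy of \<open>Q\<close> to miss the
    values already taken.\<close>
  obtain m where m: "Range R \<subseteq> {..m}"
    using finite_nat_set_iff_bounded_le[of "Range R"] R(1) by (auto simp: finite_Range)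
  obtain j where j: "inj_on j {..<N}" "j ` {..<N} \<subseteq> V - {..m}"
    "\<And>i a. i \<le> n \<Longrightarrow> a < N \<Longrightarrow> g' i (j a) = j (s i a)"
    using rich_copies[OF g', of s N m] s_perm by blast
  define S where "S = (\<lambda>a. (b a, j a)) ` {..<N}"
  have bQ: "b a \<in> Q" if "a < N" for a
    using b that by (auto simp: bij_betw_def)
  have S_iff: "x = x' \<longleftrightarrow> y = y'" if "(x, y) \<in> S" "(x', y') \<in> S" for x y x' y'
    using that b j(1) by (auto simp: S_def bij_betw_def inj_on_def)
  have S_step: "(g i x, g' i y) \<in> S" if xy: "(x, y) \<in> S" and i: "i \<le> n" for x y i
  proof -
    obtain a where a: "a < N" "x = b a" "y = j a"
      using xy by (auto simp: S_def)
    then have "(g i x, g' i y) = (b (s i a), j (s i a))"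
      using s(1)[OF i a(1)] j(3)[OF i a(1)] by simp
    then show ?thesis
      using s(2)[OF i a(1)] by (auto simp: S_def)
  qed
  have RS: "x \<noteq> x' \<and> y \<noteq> y'" if R: "(x, y) \<in> R" and S: "(x', y') \<in> S" for x y x' y'
  proof -
    obtain a where a: "a < N" "x' = b a" "y' = j a"
      using S by (auto simp: S_def)
    have "x' \<notin> Domain R"
      using bQ[OF a(1)] a by (simp add: Q_def)
    moreover have "y' \<notin> {..m}"
      using j(2) a by blast
    ultimately show ?thesis
      using R m by blast
  qed
  have "partial_iso n V g g' (R \<union> S)"
    unfolding partial_iso_def
  proof (intro conjI allI impI)
    show "finite (R \<union> S)"
      using R(1) by (simp add: S_def)
    show "R \<union> S \<subseteq> V \<times> V"
      using R(2) bQ j(2) by (auto simp: S_def Q_def)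
    show "(g i x, g' i y) \<in> R \<union> S" if "(x, y) \<in> R \<union> S" "i \<le> n" for x y i
      using that R(4) S_step by blast
    show "x = x' \<longleftrightarrow> y = y'" if "(x, y) \<in> R \<union> S" "(x', y') \<in> R \<union> S" for x y x' y'
      using that R(3)[of x y x' y'] S_iff[of x y x' y'] RS[of x y x' y'] RS[of x' y' x y]
      by (metis UnE)
  qed
  moreover have "x \<in> Domain (R \<union> S)"
  proof (cases "x \<in> Domain R")
    case False
    then have "x \<in> b ` {..<N}"
      using F(2) \<open>x \<in> V\<close> b by (simp add: Q_def bij_betw_def)
    then show ?thesis
      by (auto simp: S_def)
  qed blast
  ultimately show ?thesis
    using that[of "R \<union> S"] by blast
qed

text \<open>The second extension is applied to the converse relation. For \<open>k\<close> outside
  \<open>V\<close> nothing is done, so the stages can run over all natural numbers.\<close>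

lemma partial_iso_extend_both:
  assumes g: "rich n V g" and g': "rich n V g'" and R: "partial_iso n V g g' R"
  shows "\<exists>R'. partial_iso n V g g' R' \<and> R \<subseteq> R' \<and> (k \<in> V \<longrightarrow> k \<in> Domain R' \<and> k \<in> Range R')"
proof (cases "k \<in> V")
  case True
  obtain R' where R': "partial_iso n V g g' R'" "R \<subseteq> R'" "k \<in> Domain R'"
    using partial_iso_extend[OF g g' R True] by blast
  obtain R'' where R'': "partial_iso n V g' g R''" "R'\<inverse> \<subseteq> R''" "k \<in> Domain R''"
    using partial_iso_extend[OF g' g partial_iso_converse[OF R'(1)] True] by blast
  have sub: "R' \<subseteq> R''\<inverse>"
    using R''(2) by auto
  have "k \<in> Domain (R''\<inverse>)" "k \<in> Range (R''\<inverse>)"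
    using R'(3) R''(3) Domain_mono[OF sub] by auto
  then show ?thesis
    using R'(2) sub partial_iso_converse[OF R''(1)] by (meson order_trans)
qed (use R in blast)

lemma rich_isomorphic:
  assumes g: "rich n V g" and g': "rich n V g'"
  obtains h where "bij_betw h V V" "\<And>x i. x \<in> V \<Longrightarrow> i \<le> n \<Longrightarrow> h (g i x) = g' i (h x)"
proof -
  \<comment> \<open>Stage \<open>k\<close> treats the number \<open>k\<close> itself, so no
    enumeration of \<open>V\<close> is chosen. The start is the empty relation.\<close>
  have "\<exists>R. \<forall>k. partial_iso n V g g' (R k) \<and>
    (R k \<subseteq> R (Suc k) \<and> (k \<in> V \<longrightarrow> k \<in> Domain (R (Suc k)) \<and> k \<in> Range (R (Suc k))))"
    by (rule dependent_nat_choice)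
      (use partial_iso_extend_both[OF g g'] in \<open>auto simp: partial_iso_def intro: exI[of _ "{}"]\<close>)
  then obtain R where R: "\<And>k. partial_iso n V g g' (R k)" "\<And>k. R k \<subseteq> R (Suc k)"
    "\<And>k. k \<in> V \<Longrightarrow> k \<in> Domain (R (Suc k)) \<and> k \<in> Range (R (Suc k))"
    by metis
  define T where "T = (\<Union>k. R k)"
  have mono: "R k \<subseteq> R l" if "k \<le> l" for k l
    using lift_Suc_mono_le[of R, OF R(2) that] .
  have T_iff: "x = x' \<longleftrightarrow> y = y'" if T: "(x, y) \<in> T" "(x', y') \<in> T" for x y x' y'
  proof -
    obtain k l where "(x, y) \<in> R k" "(x', y') \<in> R l"
      using T by (auto simp: T_def)
    then have "(x, y) \<in> R (max k l)" "(x', y') \<in> R (max k l)"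
      using mono[of k "max k l"] mono[of l "max k l"] by auto
    then show ?thesis
      using partial_isoD(3)[OF R(1)] by blast
  qed
  have T_V: "T \<subseteq> V \<times> V"
    using partial_isoD(2)[OF R(1)] unfolding T_def by blast
  have T_step: "(g i x, g' i y) \<in> T" if "(x, y) \<in> T" "i \<le> n" for x y i
    using that partial_isoD(4)[OF R(1)] unfolding T_def by blast
  have Dom: "\<exists>y. (x, y) \<in> T" and Ran: "\<exists>y. (y, x) \<in> T" if "x \<in> V" for x
    using R(3)[OF that] unfolding T_def by blast+
  define h where "h x = (SOME y. (x, y) \<in> T)" for x
  have h: "(x, h x) \<in> T" if "x \<in> V" for x
    unfolding h_def using Dom[OF that] by (rule someI_ex)
  have h_eq: "h x = y" if "(x, y) \<in> T" for x y
    using h[of x] that T_V T_iff[of x y x "h x"] by blast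
  have "inj_on h V"
    by (rule inj_onI) (use T_iff[OF h h] in blast)
  moreover have "h ` V = V"
  proof (intro equalityI subsetI)
    show "y \<in> V" if "y \<in> h ` V" for y
      using that h T_V by blast
    show "y \<in> h ` V" if "y \<in> V" for y
    proof -
      obtain x where "(x, y) \<in> T"
        using Ran[of y] \<open>y \<in> V\<close> by blast
      then show ?thesis
        using h_eq[of x y] T_V by blast
    qed
  qed
  ultimately have "bij_betw h V V"
    by (simp add: bij_betw_def)
  moreover have "h (g i x) = g' i (h x)" if "x \<in> V" "i \<le> n" for x i
    by (rule h_eq[OF T_step[OF h]]) (use that in auto)
  ultimately show ?thesis
    using that by blast
qed

section \<open>The Polish group of an exhaustive ideal\<close>

locale exhaustive_ideal =
  fixes I :: "nat set set" and \<phi> :: "nat set \<Rightarrow> ennreal"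
  assumes ideal: "ideal_on_nat I"
    and fin_in: "finite A \<Longrightarrow> A \<in> I"
    and lsc: "lsc_submeasure \<phi>"
    and I_eq: "I = Exh \<phi>"
    and pos: "\<phi> {n} > 0"
begin

section \<open>The submeasure on its ideal\<close>

lemma I_subset: "A \<in> I \<Longrightarrow> B \<subseteq> A \<Longrightarrow> B \<in> I"
  and I_Un: "A \<in> I \<Longrightarrow> B \<in> I \<Longrightarrow> A \<union> B \<in> I"
  using ideal unfolding ideal_on_nat_def by blast+

lemma phi_empty: "\<phi> {} = 0"
  and phi_mono: "A \<subseteq> B \<Longrightarrow> \<phi> A \<le> \<phi> B"
  and phi_Un: "\<phi> (A \<union> B) \<le> \<phi> A + \<phi> B"
  and phi_sing: "\<phi> {n} < \<infinity>"
  and phi_lim: "incseq C \<Longrightarrow> (\<lambda>m. \<phi> (C m)) \<longlonglongrightarrow> \<phi> (\<Union>m. C m)"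
  using lsc by (auto simp: lsc_submeasure_def)

lemma phi_finite: "finite A \<Longrightarrow> \<phi> A < \<infinity>"
proof (induction A rule: finite_induct)
  case (insert x F)
  have "\<phi> (insert x F) \<le> \<phi> {x} + \<phi> F"
    using phi_Un[of "{x}" F] by simp
  also have "\<dots> < \<infinity>"
    using insert.IH phi_sing by simp
  finally show ?case .
qed (simp add: phi_empty)

lemma phi_tail: "A \<in> I \<Longrightarrow> e > 0 \<Longrightarrow> \<exists>m. \<phi> (A - {..m}) < e"
  using order_tendstoD(2)[of "\<lambda>m. \<phi> (A - {..m})" 0 sequentially e]
  by (auto simp: I_eq Exh_def eventually_sequentially)

text \<open>Tails decrease with \<open>m\<close>, so one small tail for each \<open>e\<close>
  already gives convergence.\<close>

lemma in_II:
  assumes "\<And>e. e > 0 \<Longrightarrow> \<exists>m. \<phi> (A - {..m}) < e"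
  shows "A \<in> I"
  unfolding I_eq Exh_def mem_Collect_eq
proof (rule order_tendstoI)
  fix e :: ennreal assume "0 < e"
  then obtain m where m: "\<phi> (A - {..m}) < e"
    using assms by blast
  have "\<phi> (A - {..n}) < e" if "n \<ge> m" for n
    using phi_mono[of "A - {..n}" "A - {..m}"] that m by (auto simp: subset_iff)
  then show "\<forall>\<^sub>F n in sequentially. \<phi> (A - {..n}) < e"
    by (auto simp: eventually_sequentially)
qed simp

text \<open>A set in \<open>I\<close> splits into a finite head and a tail of submeasure below 1.
  Finiteness makes the real-valued \<open>psi\<close> faithful on \<open>I\<close>.\<close>

lemma phi_I: "A \<in> I \<Longrightarrow> \<phi> A < \<infinity>"
proof -
  assume "A \<in> I"
  then obtain m where m: "\<phi> (A - {..m}) < 1"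
    using phi_tail[of A 1] by auto
  have "\<phi> A \<le> \<phi> {..m} + \<phi> (A - {..m})"
    using phi_mono[of A "{..m} \<union> (A - {..m})"] phi_Un[of "{..m}" "A - {..m}"] by auto
  also have "\<dots> < \<infinity>"
    using m phi_finite[of "{..m}"] by (auto intro: order.strict_trans)
  finally show ?thesis .
qed

definition psi :: "nat set \<Rightarrow> real" where
  "psi A = enn2real (\<phi> A)"

lemma ennreal_psi: "A \<in> I \<Longrightarrow> ennreal (psi A) = \<phi> A"
  using phi_I by (simp add: psi_def)

lemma psi_less_iff: "A \<in> I \<Longrightarrow> 0 \<le> e \<Longrightarrow> psi A < e \<longleftrightarrow> \<phi> A < ennreal e"
  by (metis ennreal_psi ennreal_less_iff psi_def enn2real_nonneg)

lemma psi_nonneg [simp]: "0 \<le> psi A"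
  by (simp add: psi_def)

lemma psi_empty [simp]: "psi {} = 0"
  by (simp add: psi_def phi_empty)

lemma psi_mono: "A \<in> I \<Longrightarrow> B \<subseteq> A \<Longrightarrow> psi B \<le> psi A"
  unfolding psi_def using phi_mono phi_I by (intro enn2real_mono) auto

lemma psi_Un: "A \<in> I \<Longrightarrow> B \<in> I \<Longrightarrow> psi (A \<union> B) \<le> psi A + psi B"
proof -
  assume AB: "A \<in> I" "B \<in> I"
  have "ennreal (psi (A \<union> B)) \<le> ennreal (psi A + psi B)"
    using AB phi_Un[of A B] by (simp add: ennreal_psi I_Un)
  then show ?thesis
    by (simp del: ennreal_plus)
qed

lemma psi_tail: "A \<in> I \<Longrightarrow> e > 0 \<Longrightarrow> \<exists>m. psi (A - {..m}) < e"
  using phi_tail[of A "ennreal e"] I_subset[of A] by (auto simp: psi_less_iff)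

lemma psi_sing: "psi {n} > 0"
  using pos[of n] phi_sing[of n] by (auto simp: psi_def enn2real_positive_iff)

text \<open>A set meeting \<open>F\<close> is at least as large as one of the singletons of
  \<open>F\<close>, all of which are positive. This is how closeness in the metric forces exact
  agreement at finitely many points.\<close>

lemma small_avoids_finite:
  assumes "finite F"
  obtains e where "e > 0" "\<And>A. A \<in> I \<Longrightarrow> psi A < e \<Longrightarrow> A \<inter> F = {}"
proof
  \<comment> \<open>The extra 1 only keeps the minimum defined for empty \<open>F\<close>.\<close>
  show "Min (insert 1 ((\<lambda>n. psi {n}) ` F)) > 0"
    using assms psi_sing by auto
  show "A \<inter> F = {}" if A: "A \<in> I" and "psi A < Min (insert 1 ((\<lambda>n. psi {n}) ` F))" for A
  proof -
    have "psi A < psi {n}" if "n \<in> F" for n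
      using \<open>psi A < _\<close> assms that by auto
    moreover have "psi {n} \<le> psi A" if "n \<in> A" for n
      using A that by (intro psi_mono) auto
    ultimately show ?thesis
      by force
  qed
qed

section \<open>The group and its operations\<close>

abbreviation G :: "(nat \<Rightarrow> nat) monoid" where
  "G \<equiv> S_ideal I"

lemma carrier_G: "carrier G = {g. bij g \<and> supp g \<in> I}"
  by (simp add: S_ideal_def Bij_UNIV)

lemma mult_G: "g \<in> carrier G \<Longrightarrow> h \<in> carrier G \<Longrightarrow> g \<otimes>\<^bsub>G\<^esub> h = g \<circ> h"
  by (auto simp: S_ideal_def BijGroup_def Bij_UNIV compose_def)

lemma subgroup_G: "subgroup (carrier G) (BijGroup UNIV)"
proof (intro group.subgroupI group_BijGroup)
  show "carrier G \<subseteq> carrier (BijGroup UNIV)"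
    by (auto simp: S_ideal_def BijGroup_def)
  have "id \<in> carrier G"
    by (simp add: carrier_G supp_def fin_in)
  then show "carrier G \<noteq> {}"
    by blast
  show "inv\<^bsub>BijGroup UNIV\<^esub> g \<in> carrier G" if "g \<in> carrier G" for g
    using that by (simp add: carrier_G inv_BijGroup Bij_UNIV bij_imp_bij_inv supp_inv restrict_UNIV)
  show "g \<otimes>\<^bsub>BijGroup UNIV\<^esub> h \<in> carrier G" if "g \<in> carrier G" "h \<in> carrier G" for g h
  proof -
    have "g \<otimes>\<^bsub>BijGroup UNIV\<^esub> h = g \<circ> h"
      using that mult_G[of g h] by (simp add: S_ideal_def)
    then show ?thesis
      using that I_subset[OF I_Un supp_comp] by (simp add: carrier_G bij_comp)
  qed
qed

lemma group_G: "group G"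
  using subgroup.subgroup_is_group[OF subgroup_G group_BijGroup]
  by (simp add: S_ideal_def)

lemma inv_G: "g \<in> carrier G \<Longrightarrow> inv\<^bsub>G\<^esub> g = pinv g"
  using group.m_inv_consistent[OF group_BijGroup subgroup_G, of g]
  by (simp add: S_ideal_def inv_BijGroup Bij_UNIV restrict_UNIV)

lemma G_comp: "g \<in> carrier G \<Longrightarrow> h \<in> carrier G \<Longrightarrow> g \<circ> h \<in> carrier G"
  using group.is_monoid[OF group_G] monoid.m_closed mult_G by metis

lemma G_inv: "g \<in> carrier G \<Longrightarrow> pinv g \<in> carrier G"
  using group.inv_closed[OF group_G] inv_G by metis

lemma G_bij: "g \<in> carrier G \<Longrightarrow> bij g"
  and G_supp: "g \<in> carrier G \<Longrightarrow> supp g \<in> I"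
  by (auto simp: carrier_G)

section \<open>The metric and continuity of the group operations\<close>

definition dist_G :: "(nat \<Rightarrow> nat) \<Rightarrow> (nat \<Rightarrow> nat) \<Rightarrow> real" where
  "dist_G f g = psi (diff f g)"

lemma diff_in: "f \<in> carrier G \<Longrightarrow> g \<in> carrier G \<Longrightarrow> diff f g \<in> I"
  by (rule I_subset[OF I_Un[OF G_supp G_supp], of f g]) (auto simp: diff_def supp_def)

sublocale Metric_space "carrier G" dist_G
proof
  show "dist_G f g = 0 \<longleftrightarrow> f = g" if "f \<in> carrier G" "g \<in> carrier G" for f g
  proof
    assume 0: "dist_G f g = 0"
    have "diff f g = {}"
    proof (rule ccontr)
      assume "diff f g \<noteq> {}"
      then obtain n where "n \<in> diff f g"
        by blast
      then have "psi {n} \<le> psi (diff f g)"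
        using diff_in[OF that] by (intro psi_mono) auto
      then show False
        using 0 psi_sing[of n] by (simp add: dist_G_def)
    qed
    then show "f = g"
      by (auto simp: diff_def)
  qed (simp add: dist_G_def diff_def)
  show "dist_G f h \<le> dist_G f g + dist_G g h"
    if "f \<in> carrier G" "g \<in> carrier G" "h \<in> carrier G" for f g h
  proof -
    have "psi (diff f h) \<le> psi (diff f g \<union> diff g h)"
      using that by (intro psi_mono I_Un diff_in) (auto simp: diff_def)
    also have "\<dots> \<le> psi (diff f g) + psi (diff g h)"
      using that by (intro psi_Un diff_in)
    finally show ?thesis
      by (simp add: dist_G_def)
  qed
  show "dist_G f g = dist_G g f" for f g
    by (simp add: dist_G_def diff_def eq_commute)
qed (simp add: dist_G_def)

lemma tau_eq: "tau I \<phi> = mtopology"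
proof -
  have "(\<lambda>f g. enn2real (\<phi> {n. f n \<noteq> g n})) = dist_G"
    by (simp add: fun_eq_iff dist_G_def diff_def psi_def)
  then show ?thesis
    by (simp add: tau_def)
qed

text \<open>A set \<open>A\<close> of small submeasure avoids the preimage of \<open>{..m}\<close> under \<open>g\<close>, so the part of \<open>g ` A\<close>
  outside \<open>A\<close> lies in a tail of the support of \<open>g\<close>.\<close>

lemma image_small:
  assumes g: "g \<in> carrier G" and "e > 0"
  obtains \<delta> where "\<delta> > 0" "\<And>A. A \<in> I \<Longrightarrow> psi A < \<delta> \<Longrightarrow> g ` A \<in> I \<and> psi (g ` A) < e"
proof -
  obtain m where m: "psi (supp g - {..m}) < e/2"
    using psi_tail[OF G_supp[OF g], of "e/2"] \<open>e > 0\<close> by auto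
  have "bij g" "inj g"
    using G_bij[OF g] by (auto simp: bij_is_inj)
  obtain \<delta> where "\<delta> > 0" and \<delta>: "\<And>A. A \<in> I \<Longrightarrow> psi A < \<delta> \<Longrightarrow> A \<inter> pinv g ` {..m} = {}"
    using small_avoids_finite[of "pinv g ` {..m}"] by auto
  show ?thesis
  proof
    show "min \<delta> (e/2) > 0"
      using \<open>\<delta> > 0\<close> \<open>e > 0\<close> by simp
    fix A assume A: "A \<in> I" "psi A < min \<delta> (e/2)"
    have "g x \<notin> {..m}" if "x \<in> A" for x
    proof
      assume "g x \<in> {..m}"
      then have "pinv g (g x) \<in> pinv g ` {..m}"
        by blast
      with that show False
        using \<delta>[of A] A \<open>inj g\<close> by auto
    qed
    moreover have "g x \<in> supp g" if "g x \<noteq> x" for x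
      using that \<open>inj g\<close> by (auto simp: supp_def dest: injD)
    ultimately have sub: "g ` A \<subseteq> A \<union> (supp g - {..m})"
      by (metis (no_types, lifting) DiffI UnCI image_subsetI)
    have tail: "supp g - {..m} \<in> I"
      using G_supp[OF g] I_subset by blast
    have in_I: "A \<union> (supp g - {..m}) \<in> I"
      using A tail I_Un by blast
    have "psi (g ` A) \<le> psi A + psi (supp g - {..m})"
      using psi_mono[OF in_I sub] psi_Un[OF A(1) tail] by linarith
    with m A show "g ` A \<in> I \<and> psi (g ` A) < e"
      using I_subset[OF in_I sub] by auto
  qed
qed

text \<open>By \<open>diff_inv\<close> the inverses differ exactly on an image under the fixed
  \<open>f\<close>, to which \<open>image_small\<close> applies. The bound depends on
  \<open>f\<close>.\<close>

lemma dist_inv_small: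
  assumes f: "f \<in> carrier G" and "e > 0"
  obtains \<delta> where "\<delta> > 0"
    "\<And>g. g \<in> carrier G \<Longrightarrow> dist_G f g < \<delta> \<Longrightarrow> dist_G (pinv f) (pinv g) < e"
proof -
  obtain \<delta> where "\<delta> > 0" and \<delta>: "\<And>A. A \<in> I \<Longrightarrow> psi A < \<delta> \<Longrightarrow> f ` A \<in> I \<and> psi (f ` A) < e"
    using image_small[OF assms] by blast
  then show ?thesis
    using that f by (auto simp: dist_G_def diff_inv G_bij diff_in)
qed

lemma continuous_inv: "continuous_map mtopology mtopology (\<lambda>x. inv\<^bsub>G\<^esub> x)"
  unfolding continuous_map_to_metric
proof (intro ballI allI impI)
  fix f e assume f: "f \<in> topspace mtopology" and "(e::real) > 0"
  then have f: "f \<in> carrier G"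
    by simp
  obtain \<delta> where "\<delta> > 0" and
    \<delta>: "\<And>g. g \<in> carrier G \<Longrightarrow> dist_G f g < \<delta> \<Longrightarrow> dist_G (pinv f) (pinv g) < e"
    using dist_inv_small[OF f \<open>e > 0\<close>] by blast
  show "\<exists>U. openin mtopology U \<and> f \<in> U \<and> (\<forall>y\<in>U. inv\<^bsub>G\<^esub> y \<in> mball (inv\<^bsub>G\<^esub> f) e)"
    using f \<open>\<delta> > 0\<close> \<delta> by (intro exI[of _ "mball f \<delta>"]) (auto simp: inv_G G_inv)
qed

text \<open>Left translations are isometries, so changing \<open>g\<close> to \<open>g'\<close>
  costs nothing beyond their distance. Changing \<open>f\<close> to \<open>f'\<close> while
  composing with the fixed \<open>g\<close> pulls the disagreement back along \<open>g\<close>,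
  hence \<open>image_small\<close> for \<open>pinv g\<close>.\<close>

lemma continuous_mult:
  "continuous_map (prod_topology mtopology mtopology) mtopology (\<lambda>(x, y). x \<otimes>\<^bsub>G\<^esub> y)"
  unfolding continuous_map_to_metric
proof (intro ballI allI impI)
  fix p e assume p: "p \<in> topspace (prod_topology mtopology mtopology)" and "(e::real) > 0"
  obtain f g where p_eq: "p = (f, g)" and f: "f \<in> carrier G" and g: "g \<in> carrier G"
    using p by auto
  obtain \<delta> where "\<delta> > 0" and
    \<delta>: "\<And>A. A \<in> I \<Longrightarrow> psi A < \<delta> \<Longrightarrow> pinv g ` A \<in> I \<and> psi (pinv g ` A) < e/2"
    using image_small[OF G_inv[OF g], of "e/2"] \<open>e > 0\<close> by auto
  have "dist_G (f \<circ> g) (f' \<circ> g') < e"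
    if f': "f' \<in> carrier G" "dist_G f f' < \<delta>" and g': "g' \<in> carrier G" "dist_G g g' < e/2" for f' g'
  proof -
    have "diff (f \<circ> g) (f' \<circ> g) = pinv g ` diff f f'"
      unfolding bij_vimage_eq_inv_image[OF G_bij[OF g], symmetric] by (simp add: diff_def vimage_def)
    then have 1: "dist_G (f \<circ> g) (f' \<circ> g) < e/2"
      using \<delta>[OF diff_in[OF f f'(1)] f'(2)[unfolded dist_G_def]] by (simp add: dist_G_def)
    have "diff (f' \<circ> g) (f' \<circ> g') = diff g g'"
      using bij_is_inj[OF G_bij[OF f'(1)]] by (simp add: diff_def inj_eq)
    then have 2: "dist_G (f' \<circ> g) (f' \<circ> g') < e/2"
      using g' by (simp add: dist_G_def)
    show ?thesis
      using triangle[of "f \<circ> g" "f' \<circ> g" "f' \<circ> g'"] 1 2 f f' g g' by (simp add: G_comp)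
  qed
  moreover have "openin (prod_topology mtopology mtopology) (mball f \<delta> \<times> mball g (e/2))"
    by (simp add: openin_prod_Times_iff)
  ultimately show "\<exists>U. openin (prod_topology mtopology mtopology) U \<and> p \<in> U \<and>
      (\<forall>q\<in>U. (case q of (x, y) \<Rightarrow> x \<otimes>\<^bsub>G\<^esub> y) \<in> mball (case p of (x, y) \<Rightarrow> x \<otimes>\<^bsub>G\<^esub> y) e)"
    using f g \<open>\<delta> > 0\<close> \<open>e > 0\<close>
    by (intro exI[of _ "mball f \<delta> \<times> mball g (e/2)"]) (auto simp: p_eq mult_G G_comp)
qed

section \<open>Finitely supported permutations and separability\<close>

lemma finite_supp_dense:
  assumes "f \<in> carrier G" "e > 0"
  obtains h where "h \<in> carrier G" "finite (supp h)" "dist_G f h < e"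
proof -
  obtain m where m: "psi (supp f - {..m}) < e"
    using psi_tail[OF G_supp] assms by blast
  obtain h where h: "bij h" "finite (supp h)" "supp h \<subseteq> supp f" "\<And>x. x \<le> m \<Longrightarrow> h x = f x"
    using bij_extend_finite[OF G_bij[OF assms(1)], of m] by blast
  \<comment> \<open>Up to \<open>m\<close> the two agree by choice of \<open>h\<close>; off
    \<open>supp f\<close> both are the identity.\<close>
  have sub: "diff f h \<subseteq> supp f - {..m}"
    using h(3,4) by (force simp: diff_def supp_def)
  have tail: "supp f - {..m} \<in> I"
    using G_supp[OF assms(1)] I_subset by blast
  have "dist_G f h < e"
    using psi_mono[OF tail sub] m unfolding dist_G_def by linarith
  then show ?thesis
    using that h by (auto simp: carrier_G fin_in)
qed

lemma separable_G: "separable_space mtopology"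
  unfolding separable_space_def
proof (intro exI conjI)
  let ?C = "{h. bij h \<and> finite (supp h)}"
  show "countable ?C"
    by (rule countable_finite_supp)
  show "?C \<subseteq> topspace mtopology"
    unfolding topspace_mtopology by (auto simp: carrier_G fin_in)
  show "mtopology closure_of ?C = topspace mtopology"
    unfolding metric_closure_of topspace_mtopology
  proof (intro equalityI subsetI CollectI conjI allI impI)
    fix f r assume f: "f \<in> carrier G" and "(r::real) > 0"
    then obtain h where "h \<in> carrier G" "finite (supp h)" "dist_G f h < r"
      using finite_supp_dense by blast
    then show "\<exists>y\<in>?C. y \<in> mball f r"
      using f G_bij by auto
  qed auto
qed

section \<open>Complete metrizability\<close>

text \<open>The usual symmetrization of a left-invariant metric: a Cauchy sequence for it has Cauchy
  inverses as well.\<close>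

definition dist2 :: "(nat \<Rightarrow> nat) \<Rightarrow> (nat \<Rightarrow> nat) \<Rightarrow> real" where
  "dist2 f g = dist_G f g + dist_G (pinv f) (pinv g)"

sublocale two: Metric_space "carrier G" dist2
proof
  show "dist2 f g = 0 \<longleftrightarrow> f = g" if "f \<in> carrier G" "g \<in> carrier G" for f g
    using that zero[of f g] nonneg[of f g] nonneg[of "pinv f" "pinv g"] mdist_zero[OF G_inv, of f]
    unfolding dist2_def by (metis add_nonneg_eq_0_iff)
  show "dist2 f h \<le> dist2 f g + dist2 g h"
    if "f \<in> carrier G" "g \<in> carrier G" "h \<in> carrier G" for f g h
    using triangle[OF that] triangle[of "pinv f" "pinv g" "pinv h"] that by (simp add: dist2_def G_inv)
qed (auto simp: dist2_def commute)

text \<open>One inclusion holds because \<open>dist2\<close> dominates \<open>dist_G\<close>; the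
  other is continuity of inversion.\<close>

lemma two_mtopology: "two.mtopology = mtopology"
proof (rule topology_eq[THEN iffD2], intro allI iffI)
  fix U
  have "two.mball x r \<subseteq> mball x r" for x r
    unfolding mball_def two.mball_def dist2_def using nonneg by (auto intro: le_less_trans[rotated])
  then show "openin two.mtopology U" if "openin mtopology U"
    using that unfolding openin_mtopology two.openin_mtopology by (meson order_trans)
  have "\<exists>r'>0. mball x r' \<subseteq> two.mball x r" if x: "x \<in> carrier G" and r: "r > 0" for x r
  proof -
    obtain \<delta> where "\<delta> > 0" and
      \<delta>: "\<And>g. g \<in> carrier G \<Longrightarrow> dist_G x g < \<delta> \<Longrightarrow> dist_G (pinv x) (pinv g) < r/2"
      using dist_inv_small[OF x, of "r/2"] r by auto
    have "mball x (min \<delta> (r/2)) \<subseteq> two.mball x r"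
      using \<delta> by (fastforce simp: dist2_def)
    then show ?thesis
      using \<open>\<delta> > 0\<close> r by (intro exI[of _ "min \<delta> (r/2)"]) auto
  qed
  then show "openin mtopology U" if "openin two.mtopology U"
    using that unfolding openin_mtopology two.openin_mtopology by (meson order_trans subsetD)
qed

text \<open>Convergence of the inverses makes the pointwise limit of a Cauchy sequence a bijection; this
  fails for the left-invariant metric \<^term>\<open>dist_G\<close> alone.\<close>

lemma pointwise_limit:
  fixes \<sigma> :: "nat \<Rightarrow> nat \<Rightarrow> nat"
  assumes \<sigma>: "\<And>k. \<sigma> k \<in> carrier G"
    and cauchy: "\<And>e. e > 0 \<Longrightarrow> \<exists>N. \<forall>k\<ge>N. \<forall>l\<ge>N. dist_G (\<sigma> k) (\<sigma> l) < e"
  obtains f where "\<And>x. \<exists>N. \<forall>k\<ge>N. \<sigma> k x = f x"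
    and "\<And>e. e > 0 \<Longrightarrow> \<exists>N. \<forall>k\<ge>N. diff (\<sigma> k) f \<in> I \<and> psi (diff (\<sigma> k) f) < e"
proof -
  have "\<exists>y N. \<forall>k\<ge>N. \<sigma> k x = y" for x
  proof -
    obtain e where "e > 0" and e: "\<And>A. A \<in> I \<Longrightarrow> psi A < e \<Longrightarrow> A \<inter> {x} = {}"
      using small_avoids_finite[of "{x}"] by auto
    obtain N where N: "\<forall>k\<ge>N. \<forall>l\<ge>N. dist_G (\<sigma> k) (\<sigma> l) < e"
      using cauchy[OF \<open>e > 0\<close>] by blast
    have "\<sigma> k x = \<sigma> N x" if "k \<ge> N" for k
    proof -
      have "psi (diff (\<sigma> k) (\<sigma> N)) < e"
        using N that by (simp flip: dist_G_def)
      then have "diff (\<sigma> k) (\<sigma> N) \<inter> {x} = {}"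
        using e diff_in \<sigma> by blast
      then show ?thesis
        by (auto simp: diff_def)
    qed
    then show ?thesis
      by blast
  qed
  then obtain f where f: "\<And>x. \<exists>N. \<forall>k\<ge>N. \<sigma> k x = f x"
    by metis
  \<comment> \<open>Lower semi-continuity carries the Cauchy bound to the limit: on the finite piece
    \<open>C m\<close>, \<open>f\<close> agrees with some late \<open>\<sigma> l\<close>, and the
    pieces exhaust the disagreement set.\<close>
  have le: "\<exists>N. \<forall>k\<ge>N. \<phi> (diff (\<sigma> k) f) \<le> ennreal e" if e: "e > 0" for e
  proof -
    obtain N where N: "\<forall>k\<ge>N. \<forall>l\<ge>N. dist_G (\<sigma> k) (\<sigma> l) < e"
      using cauchy[OF e] by blast
    have "\<phi> (diff (\<sigma> k) f) \<le> ennreal e" if "k \<ge> N" for k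
    proof -
      define C where "C m = diff (\<sigma> k) f \<inter> {..m}" for m
      have "\<phi> (C m) \<le> ennreal e" for m
      proof -
        obtain L where L: "\<And>x l. l \<ge> L x \<Longrightarrow> \<sigma> l x = f x"
          using f by metis
        define l where "l = Max (insert N (L ` {..m}))"
        have "l \<ge> N"
          unfolding l_def by (rule Max_ge) auto
        have "l \<ge> L x" if "x \<le> m" for x
          unfolding l_def using that by (intro Max_ge) auto
        then have "C m \<subseteq> diff (\<sigma> k) (\<sigma> l)"
          using L by (auto simp: C_def diff_def)
        then have "\<phi> (C m) \<le> \<phi> (diff (\<sigma> k) (\<sigma> l))"
          by (rule phi_mono)
        also have "\<dots> = ennreal (dist_G (\<sigma> k) (\<sigma> l))"
          using \<sigma> by (simp add: dist_G_def ennreal_psi diff_in)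
        also have "\<dots> \<le> ennreal e"
          using N \<open>k \<ge> N\<close> \<open>l \<ge> N\<close> by (intro ennreal_leI) (auto intro: less_imp_le)
        finally show ?thesis .
      qed
      moreover have "incseq C"
        by (auto simp: incseq_def C_def)
      then have "(\<lambda>m. \<phi> (C m)) \<longlonglongrightarrow> \<phi> (\<Union>m. C m)"
        by (rule phi_lim)
      moreover have "(\<Union>m. C m) = diff (\<sigma> k) f"
        by (auto simp: C_def)
      ultimately show ?thesis
        using LIMSEQ_le_const2 by metis
    qed
    then show ?thesis
      by blast
  qed
  \<comment> \<open>For arbitrary \<open>k\<close>, pass through a late \<open>\<sigma> l\<close>:
    its disagreement with \<open>f\<close> is small as a whole, and its disagreement with
    \<open>\<sigma> k\<close> lies in \<open>I\<close> and so has a small tail.\<close>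
  have in_I: "diff (\<sigma> k) f \<in> I" for k
  proof (rule in_II)
    fix e :: ennreal assume "e > 0"
    then obtain e' :: real where e': "e' > 0" "ennreal e' + ennreal e' < e"
    proof -
      obtain r :: real where "0 < ennreal r" "ennreal r < e"
        using \<open>e > 0\<close> by (metis dense ennreal_cases less_top_ennreal order.strict_trans2 top_greatest)
      then have "ennreal (r/2) + ennreal (r/2) < e" "r/2 > 0"
        by (auto simp flip: ennreal_plus)
      then show ?thesis
        using that by blast
    qed
    obtain l where l: "\<phi> (diff (\<sigma> l) f) \<le> ennreal e'"
      using le[OF \<open>e' > 0\<close>] by blast
    obtain m where m: "\<phi> (diff (\<sigma> k) (\<sigma> l) - {..m}) < ennreal e'"
      using phi_tail[OF diff_in[OF \<sigma> \<sigma>]] e' by (metis ennreal_less_zero_iff)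
    have "\<phi> (diff (\<sigma> k) f - {..m}) \<le> \<phi> ((diff (\<sigma> k) (\<sigma> l) - {..m}) \<union> diff (\<sigma> l) f)"
      by (rule phi_mono) (auto simp: diff_def)
    also have "\<dots> \<le> \<phi> (diff (\<sigma> k) (\<sigma> l) - {..m}) + \<phi> (diff (\<sigma> l) f)"
      by (rule phi_Un)
    also have "\<dots> \<le> ennreal e' + ennreal e'"
      using l m by (intro add_mono) auto
    finally show "\<exists>m. \<phi> (diff (\<sigma> k) f - {..m}) < e"
      using e' by (meson le_less_trans)
  qed
  have "\<exists>N. \<forall>k\<ge>N. diff (\<sigma> k) f \<in> I \<and> psi (diff (\<sigma> k) f) < e" if e: "e > 0" for e
  proof -
    obtain N where N: "\<forall>k\<ge>N. \<phi> (diff (\<sigma> k) f) \<le> ennreal (e/2)"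
      using le[of "e/2"] e by auto
    have "psi (diff (\<sigma> k) f) < e" if "k \<ge> N" for k
    proof -
      have "ennreal (psi (diff (\<sigma> k) f)) \<le> ennreal (e/2)"
        using N that in_I by (simp add: ennreal_psi)
      then have "psi (diff (\<sigma> k) f) \<le> e/2"
        using e by simp
      then show ?thesis
        using e by linarith
    qed
    then show ?thesis
      using in_I by blast
  qed
  with f that show ?thesis
    by blast
qed

lemma two_mcomplete: "two.mcomplete"
  unfolding two.mcomplete_def
proof (intro allI impI)
  fix \<sigma> assume *: "two.MCauchy \<sigma>"
  have \<sigma>: "\<sigma> k \<in> carrier G" for k
    using * unfolding two.MCauchy_def by (simp add: image_subset_iff)
  have c: "\<exists>N. \<forall>k\<ge>N. \<forall>l\<ge>N. dist2 (\<sigma> k) (\<sigma> l) < e" if "e > 0" for e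
    using * that unfolding two.MCauchy_def by metis
  have le: "dist_G f g \<le> dist2 f g" "dist_G (pinv f) (pinv g) \<le> dist2 f g" for f g
    by (simp_all add: dist2_def)
  have c1: "\<exists>N. \<forall>k\<ge>N. \<forall>l\<ge>N. dist_G (\<sigma> k) (\<sigma> l) < e" if "e > 0" for e
    using c[OF that] le by (meson le_less_trans)
  have c2: "\<exists>N. \<forall>k\<ge>N. \<forall>l\<ge>N. dist_G (pinv (\<sigma> k)) (pinv (\<sigma> l)) < e" if "e > 0" for e
    using c[OF that] le by (meson le_less_trans)
  obtain f where f: "\<And>x. \<exists>N. \<forall>k\<ge>N. \<sigma> k x = f x"
    and f_lim: "\<And>e. e > 0 \<Longrightarrow> \<exists>N. \<forall>k\<ge>N. diff (\<sigma> k) f \<in> I \<and> psi (diff (\<sigma> k) f) < e"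
    using pointwise_limit[of \<sigma>, OF \<sigma> c1] by blast
  obtain f' where f': "\<And>x. \<exists>N. \<forall>k\<ge>N. pinv (\<sigma> k) x = f' x"
    and f'_lim: "\<And>e. e > 0 \<Longrightarrow>
      \<exists>N. \<forall>k\<ge>N. diff (pinv (\<sigma> k)) f' \<in> I \<and> psi (diff (pinv (\<sigma> k)) f') < e"
    using pointwise_limit[of "\<lambda>k. pinv (\<sigma> k)", OF G_inv[OF \<sigma>] c2] by blast
  \<comment> \<open>At one late index, both pointwise limits have already been reached at the
    arguments concerned.\<close>
  have "f' (f x) = x" for x
  proof -
    obtain N N' where N: "\<forall>k\<ge>N. \<sigma> k x = f x" "\<forall>k\<ge>N'. pinv (\<sigma> k) (f x) = f' (f x)"
      using f f' by metis
    have "pinv (\<sigma> (max N N')) (\<sigma> (max N N') x) = x"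
      using G_bij[OF \<sigma>] by (simp add: bij_is_inj)
    then show ?thesis
      using N by (metis max.cobounded1 max.cobounded2)
  qed
  moreover have "f (f' x) = x" for x
  proof -
    obtain N N' where N: "\<forall>k\<ge>N. pinv (\<sigma> k) x = f' x" "\<forall>k\<ge>N'. \<sigma> k (f' x) = f (f' x)"
      using f f' by metis
    have "\<sigma> (max N N') (pinv (\<sigma> (max N N')) x) = x"
      using G_bij[OF \<sigma>] by (simp add: bij_is_surj surj_f_inv_f)
    then show ?thesis
      using N by (metis max.cobounded1 max.cobounded2)
  qed
  ultimately have "f' \<circ> f = id" "f \<circ> f' = id"
    by (auto simp: fun_eq_iff)
  then have "bij f" and f'_eq: "f' = pinv f"
    using o_bij inv_unique_comp[of f f'] by auto
  obtain k where "diff (\<sigma> k) f \<in> I"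
    using f_lim[of 1] by auto
  \<comment> \<open>A point moved by \<open>f\<close> is moved by \<open>\<sigma> k\<close> or is a
    point where the two differ.\<close>
  then have "supp f \<in> I"
    by (rule I_subset[OF I_Un[OF G_supp[OF \<sigma>, of k]]]) (auto simp: supp_def diff_def)
  with \<open>bij f\<close> have fG: "f \<in> carrier G"
    by (simp add: carrier_G)
  have "\<exists>N. \<forall>k\<ge>N. dist2 (\<sigma> k) f < e" if "e > 0" for e
  proof -
    obtain N N' where "\<forall>k\<ge>N. psi (diff (\<sigma> k) f) < e/2"
      "\<forall>k\<ge>N'. psi (diff (pinv (\<sigma> k)) (pinv f)) < e/2"
      using f_lim[of "e/2"] f'_lim[of "e/2"] \<open>e > 0\<close> by (metis f'_eq half_gt_zero)
    then have "\<forall>k\<ge>max N N'. dist2 (\<sigma> k) f < e"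
      unfolding dist2_def dist_G_def by (metis add_strict_mono field_sum_of_halves max.bounded_iff)
    then show ?thesis
      by blast
  qed
  then have "limitin two.mtopology \<sigma> f sequentially"
    using fG \<sigma> by (simp add: two.limit_metric_sequentially)
  then show "\<exists>f. limitin two.mtopology \<sigma> f sequentially"
    by blast
qed

text \<open>Complete metrizability concerns the topology only, so \<open>dist2\<close> may witness
  it.\<close>

lemma polish_G: "polish_group G mtopology"
  unfolding polish_group_def topological_group_def
  using group_G continuous_mult continuous_inv separable_G two.Metric_space_axioms two_mcomplete
    two_mtopology
  unfolding completely_metrizable_space_def by (metis topspace_mtopology)

section \<open>Generic tuples\<close>

abbreviation tuples :: "nat \<Rightarrow> (nat \<Rightarrow> nat \<Rightarrow> nat) set" where
  "tuples n \<equiv> {..n} \<rightarrow>\<^sub>E carrier G"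

abbreviation tuple_top :: "nat \<Rightarrow> (nat \<Rightarrow> nat \<Rightarrow> nat) topology" where
  "tuple_top n \<equiv> product_topology (\<lambda>_. mtopology) {..n}"

section \<open>Openness of the generic conditions\<close>

text \<open>A small ball contains only permutations that agree with its centre on \<open>F\<close>:
  the metric topology refines pointwise convergence.\<close>

lemma openin_agree:
  assumes "finite F"
  shows "openin mtopology {h \<in> carrier G. \<forall>x\<in>F. h x = g x}"
  unfolding openin_mtopology
proof (intro conjI allI impI)
  fix h assume h: "h \<in> {h \<in> carrier G. \<forall>x\<in>F. h x = g x}"
  obtain e where "e > 0" and e: "\<And>A. A \<in> I \<Longrightarrow> psi A < e \<Longrightarrow> A \<inter> F = {}"
    using small_avoids_finite[OF assms] by blast
  have "mball h e \<subseteq> {h \<in> carrier G. \<forall>x\<in>F. h x = g x}"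
  proof
    fix k assume "k \<in> mball h e"
    then have k: "k \<in> carrier G" "psi (diff h k) < e"
      by (auto simp: dist_G_def)
    then have "diff h k \<inter> F = {}"
      using e diff_in h by blast
    then have "h x = k x" if "x \<in> F" for x
      using that by (auto simp: diff_def)
    then show "k \<in> {h \<in> carrier G. \<forall>x\<in>F. h x = g x}"
      using h k(1) by simp
  qed
  then show "\<exists>r>0. mball h r \<subseteq> {h \<in> carrier G. \<forall>x\<in>F. h x = g x}"
    using \<open>e > 0\<close> by blast
qed auto

text \<open>Both generic conditions have finite witnesses, which survive any change of the tuple
  away from finitely many points.\<close>

lemma openin_finitely_determined:
  assumes "D \<subseteq> tuples n"
    and "\<And>g. g \<in> D \<Longrightarrow> \<exists>F. finite F \<and> (\<forall>h\<in>tuples n. (\<forall>i\<le>n. \<forall>x\<in>F. h i x = g i x) \<longrightarrow> h \<in> D)"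
  shows "openin (tuple_top n) D"
  unfolding openin_product_topology_alt
proof
  fix g assume "g \<in> D"
  then obtain F where "finite F"
    and F: "\<forall>h\<in>tuples n. (\<forall>i\<le>n. \<forall>x\<in>F. h i x = g i x) \<longrightarrow> h \<in> D"
    using assms(2) by blast
  define U where "U i = {h \<in> carrier G. \<forall>x\<in>F. h x = g i x}" for i
  have "g \<in> Pi\<^sub>E {..n} U"
    using \<open>g \<in> D\<close> assms(1) by (auto simp: U_def PiE_iff)
  moreover have "Pi\<^sub>E {..n} U \<subseteq> D"
    using F by (auto simp: U_def PiE_iff)
  moreover have "openin mtopology (U i)" for i
    unfolding U_def by (rule openin_agree[OF \<open>finite F\<close>])
  ultimately show "\<exists>U. finite {i \<in> {..n}. U i \<noteq> topspace mtopology} \<and>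
      (\<forall>i\<in>{..n}. openin mtopology (U i)) \<and> g \<in> Pi\<^sub>E {..n} U \<and> Pi\<^sub>E {..n} U \<subseteq> D"
    by (intro exI[of _ U]) simp
qed

text \<open>The point \<open>x\<close> is a parameter so that each condition has a finite witness;
  quantification over \<open>x\<close> becomes a countable intersection.\<close>

definition locally_finite :: "nat \<Rightarrow> nat \<Rightarrow> (nat \<Rightarrow> nat \<Rightarrow> nat) set" where
  "locally_finite n x =
     {g \<in> tuples n. \<exists>F. finite F \<and> x \<in> F \<and> (\<forall>i\<le>n. g i ` F \<subseteq> F)}"

text \<open>The parameters form one triple so that the conditions are the image of the index set
  \<open>perm_tuples n\<close>.\<close>

definition copies ::
    "nat \<Rightarrow> nat set \<Rightarrow> nat \<times> (nat \<Rightarrow> nat \<Rightarrow> nat) \<times> nat \<Rightarrow> (nat \<Rightarrow> nat \<Rightarrow> nat) set" where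
  "copies n A = (\<lambda>(N, s, m).
     {g \<in> tuples n. \<exists>j. inj_on j {..<N} \<and> j ` {..<N} \<subseteq> A - {..m} \<and>
        (\<forall>i\<le>n. \<forall>a<N. g i (j a) = j (s i a))})"

lemma openin_locally_finite: "openin (tuple_top n) (locally_finite n x)"
proof (rule openin_finitely_determined)
  fix g assume "g \<in> locally_finite n x"
  then obtain F where "finite F" and F: "x \<in> F" "\<And>i. i \<le> n \<Longrightarrow> g i ` F \<subseteq> F"
    by (auto simp: locally_finite_def)
  have "h \<in> locally_finite n x" if "h \<in> tuples n" "\<forall>i\<le>n. \<forall>y\<in>F. h i y = g i y" for h
  proof -
    have "h i ` F \<subseteq> F" if "i \<le> n" for i
      using F(2)[OF that] \<open>\<forall>i\<le>n. \<forall>y\<in>F. h i y = g i y\<close> that by auto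
    then show ?thesis
      using that(1) \<open>finite F\<close> F(1) unfolding locally_finite_def by blast
  qed
  then show "\<exists>F. finite F \<and>
      (\<forall>h\<in>tuples n. (\<forall>i\<le>n. \<forall>x\<in>F. h i x = g i x) \<longrightarrow> h \<in> locally_finite n x)"
    using \<open>finite F\<close> by blast
qed (auto simp: locally_finite_def)

lemma openin_copies: "openin (tuple_top n) (copies n A (N, s, m))"
proof (rule openin_finitely_determined)
  fix g assume "g \<in> copies n A (N, s, m)"
  then obtain j where j: "inj_on j {..<N}" "j ` {..<N} \<subseteq> A - {..m}"
      "\<And>i a. i \<le> n \<Longrightarrow> a < N \<Longrightarrow> g i (j a) = j (s i a)"
    by (auto simp: copies_def)
  have "h \<in> copies n A (N, s, m)"
    if "h \<in> tuples n" "\<forall>i\<le>n. \<forall>x\<in>j ` {..<N}. h i x = g i x" for h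
    unfolding copies_def using that j by (auto intro!: exI[of _ j])
  then show "\<exists>F. finite F \<and>
      (\<forall>h\<in>tuples n. (\<forall>i\<le>n. \<forall>x\<in>F. h i x = g i x) \<longrightarrow> h \<in> copies n A (N, s, m))"
    by (intro exI[of _ "j ` {..<N}"]) simp
qed (auto simp: copies_def)

section \<open>Density of the generic conditions\<close>

lemma finite_supp_tuple:
  assumes U: "\<And>i. i \<in> {..n} \<Longrightarrow> openin mtopology (U i)" and f: "f \<in> Pi\<^sub>E {..n} U"
  obtains h where "\<And>i. i \<le> n \<Longrightarrow> h i \<in> U i" "\<And>i. i \<le> n \<Longrightarrow> h i \<in> carrier G"
    "\<And>i. i \<le> n \<Longrightarrow> finite (supp (h i))"
proof -
  have "\<exists>h. h \<in> U i \<and> h \<in> carrier G \<and> finite (supp h)" if "i \<le> n" for i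
  proof -
    have "f i \<in> U i"
      using f that by auto
    moreover have "openin mtopology (U i)"
      using U that by simp
    ultimately obtain r where "r > 0" and r: "mball (f i) r \<subseteq> U i" and fi: "f i \<in> carrier G"
      unfolding openin_mtopology by blast
    obtain h where "h \<in> carrier G" "finite (supp h)" "dist_G (f i) h < r"
      using finite_supp_dense[OF fi \<open>r > 0\<close>] by blast
    moreover from this have "h \<in> mball (f i) r"
      using fi by simp
    ultimately show ?thesis
      using r by blast
  qed
  then show ?thesis
    using that by metis
qed

lemma dense_locally_finite:
  "tuple_top n closure_of locally_finite n x = topspace (tuple_top n)"
proof (rule dense_in_product_topologyI)
  show "locally_finite n x \<subseteq> topspace (tuple_top n)"
    by (auto simp: locally_finite_def)
  fix U f assume U: "\<And>i. i \<in> {..n} \<Longrightarrow> openin mtopology (U i)" and f: "f \<in> Pi\<^sub>E {..n} U"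
  obtain h where h: "\<And>i. i \<le> n \<Longrightarrow> h i \<in> U i" "\<And>i. i \<le> n \<Longrightarrow> h i \<in> carrier G"
    "\<And>i. i \<le> n \<Longrightarrow> finite (supp (h i))"
    using finite_supp_tuple[OF U f] by blast
  \<comment> \<open>Each \<open>h i\<close> maps its own support into itself and fixes all other
    points, so the union of the finite supports, with \<open>x\<close> added, is invariant.\<close>
  define F where "F = insert x (\<Union>i\<le>n. supp (h i))"
  have "finite F"
    using h(3) by (simp add: F_def)
  moreover have "h i ` F \<subseteq> F" if "i \<le> n" for i
  proof
    fix z assume "z \<in> h i ` F"
    then obtain y where y: "y \<in> F" "z = h i y"
      by blast
    show "z \<in> F"
    proof (cases "h i y = y")
      case False
      then have "z \<in> supp (h i)"
        using image_supp[of "h i" y] G_bij[OF h(2)[OF that]] y by (simp add: bij_is_inj)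
      then show ?thesis
        using that by (auto simp: F_def)
    qed (use y in simp)
  qed
  moreover have "x \<in> F"
    by (simp add: F_def)
  ultimately have "restrict h {..n} \<in> locally_finite n x"
    using h(2) unfolding locally_finite_def by (auto intro!: exI[of _ F])
  moreover have "restrict h {..n} \<in> Pi\<^sub>E {..n} U"
    using h(1) by auto
  ultimately show "locally_finite n x \<inter> Pi\<^sub>E {..n} U \<noteq> {}"
    by blast
qed

text \<open>A finitely supported tuple is altered on a finite set \<open>B\<close> of size
  \<open>N\<close>, taken from \<open>A\<close> beyond all supports. The alteration lies in a tail
  of \<open>A\<close>, hence is small no matter how large \<open>N\<close> is.\<close>

lemma dense_copies:
  assumes "A \<in> I" "infinite A" and s: "\<And>i. i \<le> n \<Longrightarrow> s i permutes {..<N}"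
  shows "tuple_top n closure_of copies n A (N, s, m) = topspace (tuple_top n)"
proof (rule dense_in_product_topologyI)
  show "copies n A (N, s, m) \<subseteq> topspace (tuple_top n)"
    by (auto simp: copies_def)
  fix U f assume U: "\<And>i. i \<in> {..n} \<Longrightarrow> openin mtopology (U i)" and f: "f \<in> Pi\<^sub>E {..n} U"
  obtain h where h: "\<And>i. i \<le> n \<Longrightarrow> h i \<in> U i" "\<And>i. i \<le> n \<Longrightarrow> h i \<in> carrier G"
    "\<And>i. i \<le> n \<Longrightarrow> finite (supp (h i))"
    using finite_supp_tuple[OF U f] by blast
  have "\<exists>M. \<forall>k\<in>carrier G. diff (h i) k \<subseteq> A - {..M} \<longrightarrow> k \<in> U i" if i: "i \<le> n" for i
  proof -
    obtain r where "r > 0" and r: "mball (h i) r \<subseteq> U i"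
      using U[of i] h(1)[OF i] i unfolding openin_mtopology by blast
    obtain M where M: "psi (A - {..M}) < r"
      using psi_tail[OF \<open>A \<in> I\<close> \<open>r > 0\<close>] by blast
    have "k \<in> U i" if k: "k \<in> carrier G" "diff (h i) k \<subseteq> A - {..M}" for k
    proof -
      have "A - {..M} \<in> I"
        using \<open>A \<in> I\<close> I_subset by blast
      then have "dist_G (h i) k < r"
        using psi_mono[OF _ k(2)] M by (simp add: dist_G_def)
      then show ?thesis
        using r k(1) h(2)[OF i] by auto
    qed
    then show ?thesis
      by blast
  qed
  then obtain M where
    M: "\<And>i k. i \<le> n \<Longrightarrow> k \<in> carrier G \<Longrightarrow> diff (h i) k \<subseteq> A - {..M i} \<Longrightarrow> k \<in> U i"
    by metis
  \<comment> \<open>\<open>B\<close> must lie beyond \<open>m\<close> as \<open>copies\<close>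
    demands, beyond each \<open>M i\<close> to stay in \<open>U i\<close>, and off the supports so
    that every \<open>h i\<close> preserves both \<open>B\<close> and its complement.\<close>
  define K where "K = {..m} \<union> (\<Union>i\<le>n. {..M i} \<union> supp (h i))"
  have "infinite (A - K)"
    using h(3) \<open>infinite A\<close> by (intro Diff_infinite_finite) (auto simp: K_def)
  then obtain B where B: "finite B" "card B = N" "B \<subseteq> A - K"
    using infinite_arbitrarily_large by blast
  obtain j where j: "bij_betw j {..<N} B"
    using ex_bij_betw_nat_finite[OF B(1)] by (auto simp: B(2) atLeast0LessThan)
  define k where "k i y = (if y \<in> B then j (s i (inv_into {..<N} j y)) else h i y)" for i y
  have kj: "k i (j a) = j (s i a)" if "a < N" for i a
    using j that by (auto simp: k_def bij_betw_def inv_into_f_f)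
  have hB: "h i y = y" if "i \<le> n" "y \<in> B" for i y
    using B(3) that by (auto simp: K_def supp_def)
  have diff_k: "diff (h i) (k i) \<subseteq> B" for i
    by (auto simp: diff_def k_def)
  have k_G: "k i \<in> carrier G" if i: "i \<le> n" for i
  proof -
    have "bij_betw (j \<circ> s i \<circ> inv_into {..<N} j) B B"
      using bij_betw_trans[OF bij_betw_trans[OF bij_betw_inv_into[OF j]
            permutes_imp_bij[OF s[OF i]]] j]
      by (simp add: o_assoc)
    then have "bij_betw (k i) B B"
      by (subst bij_betw_cong[where g = "j \<circ> s i \<circ> inv_into {..<N} j"]) (auto simp: k_def)
    moreover have "bij_betw (k i) (- B) (- B)"
    proof -
      have "h i ` B = B"
        using hB[OF i] by auto
      then have "bij_betw (h i) (- B) (- B)"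
        using G_bij[OF h(2)[OF i]]
        by (metis bij_betw_subset bij_image_Compl_eq subset_UNIV)
      then show ?thesis
        by (subst bij_betw_cong[where g = "h i"]) (auto simp: k_def)
    qed
    ultimately have "bij_betw (k i) (B \<union> - B) (B \<union> - B)"
      by (rule bij_betw_combine) auto
    then have "bij (k i)"
      by simp
    have "supp (k i) \<subseteq> supp (h i) \<union> B"
      by (auto simp: supp_def k_def)
    then have "finite (supp (k i))"
      using h(3)[OF i] B(1) finite_subset by blast
    then show ?thesis
      using \<open>bij (k i)\<close> by (simp add: carrier_G fin_in)
  qed
  have "k i \<in> U i" if i: "i \<le> n" for i
    using diff_k[of i] B(3) i by (intro M k_G) (auto simp: K_def)
  then have "restrict k {..n} \<in> Pi\<^sub>E {..n} U"
    by auto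
  moreover have "restrict k {..n} \<in> copies n A (N, s, m)"
  proof -
    have "j ` {..<N} \<subseteq> A - {..m}"
      using j B(3) by (auto simp: bij_betw_def K_def)
    then show ?thesis
      using k_G kj j unfolding copies_def by (auto simp: bij_betw_def intro!: exI[of _ j])
  qed
  ultimately show "copies n A (N, s, m) \<inter> Pi\<^sub>E {..n} U \<noteq> {}"
    by blast
qed

section \<open>From generic tuples to a comeager orbit\<close>

text \<open>Tuples are extensional on \<open>{..n}\<close>; with irrelevant values fixed, there are
  only finitely many for each \<open>N\<close>, so the index set is countable.\<close>

definition perm_tuples :: "nat \<Rightarrow> (nat \<times> (nat \<Rightarrow> nat \<Rightarrow> nat) \<times> nat) set" where
  "perm_tuples n = (SIGMA N:UNIV. ({..n} \<rightarrow>\<^sub>E {p. p permutes {..<N}}) \<times> UNIV)"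

lemma countable_perm_tuples: "countable (perm_tuples n)"
  unfolding perm_tuples_def
  by (intro countable_SIGMA) (auto intro!: countable_finite[OF finite_PiE] finite_permutations)

definition dense_opens :: "nat \<Rightarrow> nat set \<Rightarrow> (nat \<Rightarrow> nat \<Rightarrow> nat) set set" where
  "dense_opens n A = range (locally_finite n) \<union> copies n A ` perm_tuples n"

text \<open>\<open>V\<close> is left free, so that one set can serve two tuples with different
  supports.\<close>

lemma generic_rich:
  assumes g: "g \<in> tuples n" "g \<in> \<Inter>(dense_opens n A)"
    and V: "A \<subseteq> V" "\<And>i. i \<le> n \<Longrightarrow> supp (g i) \<subseteq> V"
  shows "rich n V g"
  unfolding rich_def
proof (intro conjI allI impI)
  have inj: "inj (g i)" if "i \<le> n" for i
    using PiE_mem[OF g(1), of i] that by (simp add: G_bij bij_is_inj)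
  then show "inj (g i)" if "i \<le> n" for i
    using that .
  show "g i ` V \<subseteq> V" if i: "i \<le> n" for i
  proof (intro image_subsetI)
    show "g i x \<in> V" if "x \<in> V" for x
      using image_supp[OF inj[OF i], of x] V(2)[OF i] that by (cases "g i x = x") auto
  qed
  show "\<exists>F. finite F \<and> x \<in> F \<and> (\<forall>i\<le>n. g i ` F \<subseteq> F)" for x
  proof -
    have "g \<in> locally_finite n x"
      using g(2) unfolding dense_opens_def by blast
    then show ?thesis
      by (simp add: locally_finite_def)
  qed
  show "\<exists>j. inj_on j {..<N} \<and> j ` {..<N} \<subseteq> V - {..m} \<and> (\<forall>i\<le>n. \<forall>a<N. g i (j a) = j (s i a))"
    if s: "\<forall>i\<le>n. s i permutes {..<N}" for N :: nat and s m
  proof -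
    \<comment> \<open>In \<open>rich\<close> the values \<open>s i\<close> for \<open>i > n\<close>
      are arbitrary; the restriction brings \<open>s\<close> into the countable index set.\<close>
    have "(N, restrict s {..n}, m) \<in> perm_tuples n"
      using s by (auto simp: perm_tuples_def)
    then have "g \<in> copies n A (N, restrict s {..n}, m)"
      using g(2) unfolding dense_opens_def by blast
    then obtain j where "inj_on j {..<N}" "j ` {..<N} \<subseteq> A - {..m}"
      "\<And>i a. i \<le> n \<Longrightarrow> a < N \<Longrightarrow> g i (j a) = j (s i a)"
      by (auto simp: copies_def)
    then show ?thesis
      using V(1) by (intro exI[of _ j]) blast
  qed
qed

lemma generic_conjugate:
  assumes "A \<in> I"
    and g: "g \<in> tuples n" "g \<in> \<Inter>(dense_opens n A)"
    and g': "g' \<in> tuples n" "g' \<in> \<Inter>(dense_opens n A)"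
  shows "g' \<in> diag_conj_orbit G n g"
proof -
  define V where "V = A \<union> (\<Union>i\<le>n. supp (g i)) \<union> (\<Union>i\<le>n. supp (g' i))"
  have g_G: "g i \<in> carrier G" and g'_G: "g' i \<in> carrier G" if "i \<le> n" for i
    using g(1) g'(1) that by auto
  have UN: "(\<Union>i\<le>k. supp (f i)) \<in> I" if "\<And>i. i \<le> k \<Longrightarrow> f i \<in> carrier G"
    for f and k :: nat
    using that by (induction k) (auto simp: atMost_Suc intro!: I_Un G_supp)
  have "V \<in> I"
    unfolding V_def using g_G g'_G \<open>A \<in> I\<close> by (intro I_Un UN) auto
  have supp_g: "supp (g i) \<subseteq> V" and supp_g': "supp (g' i) \<subseteq> V" if "i \<le> n" for i
    using that by (auto simp: V_def)
  have "A \<subseteq> V"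
    by (auto simp: V_def)
  obtain h0 where h0: "bij_betw h0 V V" "\<And>x i. x \<in> V \<Longrightarrow> i \<le> n \<Longrightarrow> h0 (g i x) = g' i (h0 x)"
    using rich_isomorphic[OF generic_rich[OF g \<open>A \<subseteq> V\<close> supp_g] generic_rich[OF g' \<open>A \<subseteq> V\<close> supp_g']]
    by blast
  define h where "h x = (if x \<in> V then h0 x else x)" for x
  have "bij_betw h V V"
    using h0(1) by (subst bij_betw_cong[where g = h0]) (auto simp: h_def)
  moreover have "bij_betw h (- V) (- V)"
    by (subst bij_betw_cong[where g = id]) (auto simp: h_def)
  ultimately have "bij_betw h (V \<union> - V) (V \<union> - V)"
    by (rule bij_betw_combine) auto
  then have "bij h"
    by simp
  moreover have "supp h \<subseteq> V"
    by (auto simp: supp_def h_def)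
  ultimately have h_G: "h \<in> carrier G"
    using \<open>V \<in> I\<close> I_subset by (auto simp: carrier_G)
  \<comment> \<open>On \<open>V\<close>, which \<open>g i\<close> preserves, this is equivariance of
    \<open>h0\<close>; off \<open>V\<close>, both tuples and \<open>h\<close> are the
    identity.\<close>
  have eq: "h (g i x) = g' i (h x)" if i: "i \<le> n" for i x
  proof (cases "x \<in> V")
    case True
    have "g i x \<in> V"
      using image_supp[OF bij_is_inj[OF G_bij[OF g_G[OF i]]], of x] supp_g[OF i] True
      by (cases "g i x = x") auto
    then show ?thesis
      using h0(2)[OF True i] True by (simp add: h_def)
  next
    case False
    then have "g i x = x" "g' i x = x"
      using supp_g[OF i] supp_g'[OF i] by (auto simp: supp_def)
    then show ?thesis
      using False by (simp add: h_def)
  qed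
  have "h \<otimes>\<^bsub>G\<^esub> g i \<otimes>\<^bsub>G\<^esub> inv\<^bsub>G\<^esub> h = g' i" if i: "i \<le> n" for i
  proof -
    have "h \<otimes>\<^bsub>G\<^esub> g i \<otimes>\<^bsub>G\<^esub> inv\<^bsub>G\<^esub> h = h \<circ> g i \<circ> pinv h"
      using h_G g_G[OF i] by (simp add: mult_G inv_G G_comp G_inv)
    also have "\<dots> = g' i"
      using eq[OF i] bij_is_surj[OF \<open>bij h\<close>] by (simp add: fun_eq_iff surj_f_inv_f)
    finally show ?thesis .
  qed
  then have "g' = (\<lambda>i\<in>{..n}. h \<otimes>\<^bsub>G\<^esub> g i \<otimes>\<^bsub>G\<^esub> inv\<^bsub>G\<^esub> h)"
    using g'(1) by (intro extensionalityI[of g' "{..n}"]) (auto simp: PiE_iff)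
  then show ?thesis
    unfolding diag_conj_orbit_def using h_G by blast
qed

lemma diag_conj_orbit_subset: "x \<in> tuples n \<Longrightarrow> diag_conj_orbit G n x \<subseteq> tuples n"
  using group.is_monoid[OF group_G] group.inv_closed[OF group_G]
  by (auto simp: diag_conj_orbit_def intro!: monoid.m_closed)

text \<open>If there were no generic tuple, the whole space would be meager and every orbit comeager;
  so no appeal to the Baire category theorem is needed to choose \<open>x\<close>.\<close>

lemma comeager_orbit:
  assumes A: "A \<in> I" "infinite A"
  obtains x where "x \<in> tuples n" "comeager_in (tuple_top n) (diag_conj_orbit G n x)"
proof -
  define C where "C = tuples n \<inter> \<Inter>(dense_opens n A)"
  obtain x where x: "x \<in> tuples n" "C \<noteq> {} \<longrightarrow> x \<in> C"
  proof (cases "C = {}")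
    case True
    have "(\<lambda>i\<in>{..n}. id) \<in> tuples n"
      by (auto simp: carrier_G supp_def fin_in)
    then show ?thesis
      using that True by blast
  qed (use that C_def in blast)
  have "comeager_in (tuple_top n) (diag_conj_orbit G n x)"
  proof (rule comeager_inI)
    show "countable (dense_opens n A)"
      unfolding dense_opens_def using countable_perm_tuples by simp
    show "openin (tuple_top n) D \<and> tuple_top n closure_of D = topspace (tuple_top n)"
      if D: "D \<in> dense_opens n A" for D
    proof -
      consider y where "D = locally_finite n y"
        | p where "D = copies n A p" "p \<in> perm_tuples n"
        using D unfolding dense_opens_def by blast
      then show ?thesis
      proof cases
        case 1
        then show ?thesis
          using openin_locally_finite dense_locally_finite by metis
      next
        case 2
        obtain N s m where p: "p = (N, s, m)"
          by (cases p)
        have "s i permutes {..<N}" if "i \<le> n" for i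
          using 2(2) that by (auto simp: perm_tuples_def p)
        then show ?thesis
          unfolding 2(1) p using openin_copies dense_copies[OF A] by blast
      qed
    qed
    show "diag_conj_orbit G n x \<subseteq> topspace (tuple_top n)"
      using diag_conj_orbit_subset[OF x(1)] by simp
    show "topspace (tuple_top n) \<inter> \<Inter>(dense_opens n A) \<subseteq> diag_conj_orbit G n x"
    proof
      fix y assume "y \<in> topspace (tuple_top n) \<inter> \<Inter>(dense_opens n A)"
      then have "y \<in> C"
        by (simp add: C_def)
      then show "y \<in> diag_conj_orbit G n x"
        using generic_conjugate[OF A(1), of x n y] x(2) by (auto simp: C_def)
    qed
  qed
  then show ?thesis
    using that x(1) by blast
qed

lemma ample_generics_G:
  assumes "A \<in> I" "infinite A"
  shows "ample_generics G mtopology"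
  unfolding ample_generics_def using polish_G comeager_orbit[OF assms] by metis

end

theorem theorem1:
  fixes I :: "nat set set" and \<phi> :: "nat set \<Rightarrow> ennreal"
  assumes "analytic_family I" and "P_ideal I"
    and "{A. finite A} \<subset> I"
    and "lsc_submeasure \<phi>" and "I = Exh \<phi>" and "\<forall>n. \<phi> {n} > 0"
  shows "ample_generics (S_ideal I) (tau I \<phi>)"
proof -
  interpret exhaustive_ideal I \<phi>
    using assms by unfold_locales (auto simp: P_ideal_def)
  \<comment> \<open>Properness of the inclusion supplies the infinite member of \<open>I\<close>
    that houses all copies.\<close>
  obtain A where "A \<in> I" "infinite A"
    using assms(3) by blast
  then show ?thesis
    unfolding tau_eq by (rule ample_generics_G)
qed

end
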